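(* Let $T\ge 2$ be an integer. Then the series below converges and $$\ln T=\sum_{k=0}^\infty\left(\frac{1}{kT+1}+\frac{1}{kT+2}+\dots+\frac{1}{kT+(T-1)}-\frac{T-1}{kT+T}\right),$$ that is, $$\ln T=\sum_{k=0}^\infty\left(\sum_{j=1}^{T-1}\frac{1}{kT+j}-\frac{T-1}{kT+T}\right).$$
   Context: Here $\ln$ denotes the natural logarithm (base $e$). The infinite series is understood as the limit as $n\to\infty$ of the partial sums over $0\le k\le n-1$, where each term is the whole parenthesized expression. *)

theory Defs
  imports Complex_Main
begin

end

theory Submission
  imports Defs "HOL-Analysis.Harmonic_Numbers"
begin

text \<open>
  Adding and subtracting the missing fraction \<open>1 / (k T + T)\<close> turns the \<open>k\<close>-th term into a whole
  block of \<open>T\<close> consecutive unit fractions minus \<open>T / (k T + T) = 1 / (k + 1)\<close>. The blocks tile the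
  harmonic series, so the \<open>n\<close>-th partial sum is the difference \<open>harm (n * T) - harm n\<close> of
  harmonic numbers. Since
  \<open>harm m - ln m\<close> tends to Euler's constant along \<open>m = n T\<close> as well as along \<open>m = n\<close>, the constant
  cancels and leaves \<open>ln (n T) - ln n = ln T\<close>.
\<close>

lemma harm_add:
  "harm (m + T) = harm m + (\<Sum>j = 1..T. 1 / (real m + real j))"
  by (induction T) (auto simp: harm_Suc inverse_eq_divide)

lemma block_term_eq_harm_diff:
  fixes T :: nat
  assumes "T > 0"
  shows "(\<Sum>j = 1..T - 1. 1 / (real k * real T + real j)) - (real T - 1) / (real k * real T + real T)
       = (harm (Suc k * T) - harm (Suc k)) - (harm (k * T) - harm k)"
proof -
  have block: "harm (Suc k * T) = harm (k * T) + (\<Sum>j = 1..T. 1 / (real k * real T + real j))"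
    using harm_add[of "k * T" T] by (simp add: add.commute)
  have split: "(\<Sum>j = 1..T. 1 / (real k * real T + real j))
      = (\<Sum>j = 1..T - 1. 1 / (real k * real T + real j)) + 1 / (real k * real T + real T)"
    using assms by (cases T) auto
  have cancel: "real T / (real k * real T + real T) = 1 / (real k + 1)"
  proof -
    have "real k * real T + real T = real T * (real k + 1)"
      by (simp add: algebra_simps)
    then show ?thesis
      using assms by simp
  qed
  have Suc: "harm (Suc k) = harm k + 1 / (real k + 1)"
    by (simp add: harm_Suc inverse_eq_divide add.commute)
  show ?thesis
    unfolding block split Suc cancel[symmetric] by (simp add: diff_divide_distrib)
qed

lemma harm_mult_minus_harm_LIMSEQ:
  fixes T :: nat
  assumes "T > 0"
  shows "(\<lambda>n. harm (n * T) - harm n) \<longlonglongrightarrow> ln (real T)"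
proof -
  have "filterlim (\<lambda>n. n * T) at_top sequentially"
    using assms by (intro filterlim_subseq) (auto simp: strict_mono_def)
  with euler_mascheroni_LIMSEQ
  have "(\<lambda>n. harm (n * T) - ln (real (n * T))) \<longlonglongrightarrow> euler_mascheroni"
    by (rule filterlim_compose)
  from tendsto_add[OF tendsto_diff[OF this euler_mascheroni_LIMSEQ] tendsto_const[of "ln (real T)"]]
  have "(\<lambda>n. (harm (n * T) - ln (real (n * T))) - (harm n - ln (real n)) + ln (real T))
          \<longlonglongrightarrow> ln (real T)"
    by simp
  moreover have "eventually (\<lambda>n. (harm (n * T) - ln (real (n * T))) - (harm n - ln (real n)) + ln (real T)
                     = harm (n * T) - harm n) sequentially"
    using eventually_gt_at_top[of 0] by eventually_elim (use assms in \<open>simp add: ln_mult\<close>)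
  ultimately show ?thesis
    by (rule Lim_transform_eventually)
qed

theorem mainTheorem1:
  fixes T :: nat
  assumes "T \<ge> 2"
  shows "(\<lambda>k::nat. (\<Sum>j = 1..T - 1. 1 / (real k * real T + real j))
            - (real T - 1) / (real k * real T + real T)) sums ln (real T)"
proof -
  have "T > 0" using assms by simp
  from telescope_sums[OF harm_mult_minus_harm_LIMSEQ[OF this]] show ?thesis
    unfolding block_term_eq_harm_diff[OF \<open>T > 0\<close>] by (simp add: harm_def)
qed

end
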